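(* Let $\theta$ be a primitive, aperiodic block substitution on a finite alphabet $\mathcal{A}$ in $\mathbb{Z}^d$ with column number $c_\theta>1$. Let $\tau$ be a permutation of $\mathcal{A}$ and let $A\in\mathrm{GL}(d,\mathbb{Z})$ be such that $A^{-1}\odot\mathrm{supp}(\theta^n)=\mathrm{supp}(\theta^n)$ for all $n$. Let $\nu,\bar\nu\colon\mathcal{A}\to\{1,\dots,c_\theta\}$ be the pair of encodings, and $\beta^{-1}_{M,\boldsymbol j},\bar\beta^{-1}_{M,\boldsymbol j}$ the maps, defined in the context. Then the pair $(\tau,A)$ gives rise to a supertile-shuffling extended symmetry of $(\mathbb{X}_\theta,\mathbb{Z}^d)$ if and only if it satisfies the following conditions: (1) $\theta_{\boldsymbol j}(\tau[M])=\tau[\theta_{A^{-1}\odot\boldsymbol j}(M)]$ for every minimal set $M$ and all $\boldsymbol j\in\mathrm{supp}(\theta)$; (2) $\tau'$ is well defined via $\tau'\circ\nu=\bar\nu\circ\tau$, i.e. there is a permutation $\tau'$ of $\{1,\dots,c_\theta\}$ satisfying this equation; (3) $\tau'\circ\beta^{-1}_{M,\boldsymbol j}\circ(\tau')^{-1}=\bar\beta^{-1}_{\tau[M],A^{-1}\odot\boldsymbol j}$ for every minimal set $M$ and all $\boldsymbol j\in\mathrm{supp}(\theta)$.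
   Context: Block substitutions: $\mathcal{A}$ is a finite alphabet, $Q=\mathrm{diag}(\ell_1,\dots,\ell_d)$ with integers $\ell_j\ge 2$, $\mathcal{D}=\prod_{j}\{0,\dots,\ell_j-1\}$, $\theta\colon\mathcal{A}\to\mathcal{A}^{\mathcal{D}}$, with columns $\theta_{\boldsymbol j}(a)=\theta(a)_{\boldsymbol j}$. The power $\theta^n$ has support $\mathrm{supp}(\theta^n)=\prod_j\{0,\dots,\ell_j^n-1\}$ and columns $\theta^n_{\boldsymbol j}=\theta_{\boldsymbol j_0}\circ\cdots\circ\theta_{\boldsymbol j_{n-1}}$ for $\boldsymbol j=\sum_{i<n}Q^i\boldsymbol j_i$, $\boldsymbol j_i\in\mathcal{D}$. $\mathbb{X}_\theta\subseteq\mathcal{A}^{\mathbb{Z}^d}$ is the subshift whose language consists of the finite patterns occurring (up to translation) in some $\theta^k(a)$. $\theta$ is primitive if for some $k$ every $\theta^k(a)$ contains all letters, and aperiodic if no element of $\mathbb{X}_\theta$ has a non-zero period. For primitive $\theta$ one has $\mathbb{X}_\theta=\mathbb{X}_{\theta^k}$ for all $k\ge1$. Notation $\odot$: for a finite box $B\subset\mathbb{Z}^d$ let $\boldsymbol k=\boldsymbol k(B)$ be the (possibly half-integral) vector translating the centre of $B$ to the origin, and put $A\odot\boldsymbol n=A\boldsymbol n+A\boldsymbol k-\boldsymbol k$ for $\boldsymbol n\in B$. For positions in $\mathrm{supp}(\theta^n)$ the box is $\mathrm{supp}(\theta^n)$. Supertile-shuffling: $(\tau,A)$ gives rise to a supertile-shuffling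 extended symmetry if there is $N$ such that $\theta^n_{\boldsymbol i}(\tau(a))=\tau(\theta^n_{A^{-1}\odot\boldsymbol i}(a))$ for all $a\in\mathcal{A}$, $n\ge N$, $\boldsymbol i\in\mathrm{supp}(\theta^n)$; the extended symmetry is $\Phi(x)_{\boldsymbol n}=\tau(x_{A^{-1}\boldsymbol n})$. Minimal sets: $c_\theta=\min_{k\ge1}\min_{\boldsymbol j\in\mathrm{supp}(\theta^k)}|\theta^k_{\boldsymbol j}(\mathcal{A})|$ is the column number; a minimal set is a set of the form $\theta^k_{\boldsymbol j}(\mathcal{A})$ of cardinality $c_\theta$. Every column of every power of $\theta$ maps minimal sets bijectively onto minimal sets. Convention on powers: $\theta$ is tacitly replaced by a sufficiently large power, so that the supertile-shuffling relation, when it holds for all large powers, holds already for $\theta$ itself, and so that $\theta$ has an idempotent column whose image is a minimal set. Encodings: fix a minimal set $M_0$, an idempotent column $\iota=\theta_{\boldsymbol n}$ with image $M_0$, and a bijection $\nu_0\colon M_0\to\{1,\dots,c_\theta\}$. Put $\nu=\nu_0\circ\iota$, $\bar\iota=\theta_{A^{-1}\odot\boldsymbol n}$ and $\bar\nu=(\nu|_{\tau[M_0]})\circ\bar\iota$ (i.e. $\bar\nu=\nu\circ\bar\iota$, $\bar\iota$ being regarded as a column with image $\tau[M_0]$). For a minimal set $M$ and $\boldsymbol j\in\mathrm{supp}(\theta)$, define $\beta^{-1}_{M,\boldsymbol j}=\nu\circ\theta_{\boldsymbol j}\circ(\nu|_M)^{-1}$ and $\bar\beta^{-1}_{M,\boldsymbol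 j}=\bar\nu\circ\theta_{\boldsymbol j}\circ(\bar\nu|_M)^{-1}$.
   Formalization: The formal theorem takes the second encoding from the column at A⊙n instead of A^{-1}⊙n, and the index in (3) is A⊙j instead of A^{-1}⊙j; as printed the equivalence fails when A² ≠ 1 (e.g. rotation by 90 degrees), and the two versions agree when A² = 1. *)

theory Defs
  imports "HOL-Analysis.Analysis" "HOL-Combinatorics.Permutations"
begin

text \<open>
  A block substitution on the finite alphabet \<open>'a\<close> in dimension \<open>CARD('d)\<close> consists of
  the diagonal \<open>l\<close> of \<open>Q\<close> and a map \<open>\<theta>\<close> sending a letter to a
  pattern. Only the values \<open>\<theta> a j\<close> with \<open>j \<in> supp l 1\<close>
  are meaningful, and only these enter the definitions below.
\<close>

definition supp :: "int^'d \<Rightarrow> nat \<Rightarrow> (int^'d) set" where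
  "supp l n = {j. \<forall>k. 0 \<le> j $ k \<and> j $ k < (l $ k) ^ n}"

definition subst_column :: "('a \<Rightarrow> int^'d \<Rightarrow> 'a) \<Rightarrow> int^'d \<Rightarrow> 'a \<Rightarrow> 'a" where
  "subst_column \<theta> j = (\<lambda>a. \<theta> a j)"

text \<open>
  If \<open>j = j\<^sub>0 + Q j\<^sub>1 + \<dots> + Q\<^sup>n j\<^sub>n\<close> with digits \<open>j\<^sub>i \<in> supp l 1\<close>, then
  \<open>j\<^sub>0\<close> is the componentwise remainder of \<open>j\<close> modulo \<open>l\<close>, and the
  componentwise quotient has the digits \<open>j\<^sub>1, \<dots>, j\<^sub>n\<close>.
\<close>

primrec power_column ::
  "int^'d \<Rightarrow> ('a \<Rightarrow> int^'d \<Rightarrow> 'a) \<Rightarrow> nat \<Rightarrow> int^'d \<Rightarrow> 'a \<Rightarrow> 'a" where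
  "power_column l \<theta> 0 j = id"
| "power_column l \<theta> (Suc n) j =
     subst_column \<theta> (\<chi> k. j $ k mod l $ k) \<circ> power_column l \<theta> n (\<chi> k. j $ k div l $ k)"

definition primitive_subst :: "int^'d \<Rightarrow> ('a \<Rightarrow> int^'d \<Rightarrow> 'a) \<Rightarrow> bool" where
  "primitive_subst l \<theta> \<longleftrightarrow>
     (\<exists>k\<ge>1. \<forall>a b. \<exists>j\<in>supp l k. power_column l \<theta> k j a = b)"

definition subshift :: "int^'d \<Rightarrow> ('a \<Rightarrow> int^'d \<Rightarrow> 'a) \<Rightarrow> (int^'d \<Rightarrow> 'a) set" where
  "subshift l \<theta> =
     {x. \<forall>F. finite F \<longrightarrow>
           (\<exists>k a t. \<forall>n\<in>F. n + t \<in> supp l k \<and> x n = power_column l \<theta> k (n + t) a)}"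

definition aperiodic_subst :: "int^'d \<Rightarrow> ('a \<Rightarrow> int^'d \<Rightarrow> 'a) \<Rightarrow> bool" where
  "aperiodic_subst l \<theta> \<longleftrightarrow>
     \<not> (\<exists>x\<in>subshift l \<theta>. \<exists>p. p \<noteq> 0 \<and> (\<forall>n. x (n + p) = x n))"

definition column_number :: "int^'d \<Rightarrow> ('a::finite \<Rightarrow> int^'d \<Rightarrow> 'a) \<Rightarrow> nat" where
  "column_number l \<theta> =
     Min {card (range (power_column l \<theta> k j)) | k j. 1 \<le> k \<and> j \<in> supp l k}"

definition minimal_set :: "int^'d \<Rightarrow> ('a::finite \<Rightarrow> int^'d \<Rightarrow> 'a) \<Rightarrow> 'a set \<Rightarrow> bool" where
  "minimal_set l \<theta> M \<longleftrightarrow>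
     (\<exists>k\<ge>1. \<exists>j\<in>supp l k. M = range (power_column l \<theta> k j)) \<and>
     card M = column_number l \<theta>"

definition real_vec :: "int^'d \<Rightarrow> real^'d" where
  "real_vec n = (\<chi> i. real_of_int (n $ i))"

definition centre_shift :: "(int^'d) set \<Rightarrow> real^'d" where
  "centre_shift B = (\<chi> i. - (real_of_int (Min ((\<lambda>n. n $ i) ` B) + Max ((\<lambda>n. n $ i) ` B)) / 2))"

text \<open>
  \<open>odot_real A B n\<close> is \<open>A n + A k - k\<close> for \<open>k = centre_shift B\<close>; since \<open>k\<close> may be
  half-integral, it need not be a lattice point for a general \<open>A\<close>. If \<open>A\<close> preserves \<open>B\<close>
  in the sense of \<open>preserves_box\<close>, then it is one for every \<open>n \<in> B\<close>, and the rounding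
  in \<open>odot\<close> has no effect.
\<close>

definition odot_real :: "int^'d^'d \<Rightarrow> (int^'d) set \<Rightarrow> int^'d \<Rightarrow> real^'d" where
  "odot_real A B n =
     map_matrix real_of_int A *v real_vec n
       + map_matrix real_of_int A *v centre_shift B - centre_shift B"

definition odot :: "int^'d^'d \<Rightarrow> (int^'d) set \<Rightarrow> int^'d \<Rightarrow> int^'d" where
  "odot A B n = (\<chi> i. \<lfloor>odot_real A B n $ i\<rfloor>)"

definition preserves_box :: "int^'d^'d \<Rightarrow> (int^'d) set \<Rightarrow> bool" where
  "preserves_box A B \<longleftrightarrow> odot_real A B ` B = real_vec ` B"

definition shuffling_relation ::
  "int^'d \<Rightarrow> ('a \<Rightarrow> int^'d \<Rightarrow> 'a) \<Rightarrow> ('a \<Rightarrow> 'a) \<Rightarrow> int^'d^'d \<Rightarrow> nat \<Rightarrow> bool" where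
  "shuffling_relation l \<theta> \<tau> A n \<longleftrightarrow>
     (\<forall>a. \<forall>i\<in>supp l n.
        power_column l \<theta> n i (\<tau> a) =
        \<tau> (power_column l \<theta> n (odot (matrix_inv A) (supp l n) i) a))"

definition supertile_shuffling ::
  "int^'d \<Rightarrow> ('a \<Rightarrow> int^'d \<Rightarrow> 'a) \<Rightarrow> ('a \<Rightarrow> 'a) \<Rightarrow> int^'d^'d \<Rightarrow> bool" where
  "supertile_shuffling l \<theta> \<tau> A \<longleftrightarrow> (\<exists>N. \<forall>n\<ge>N. shuffling_relation l \<theta> \<tau> A n)"

text \<open>
  \<open>beta_inv \<theta> \<nu> M j\<close> is \<open>\<nu> \<circ> \<theta>\<^sub>j \<circ> (\<nu>|\<^sub>M)\<^sup>-\<^sup>1\<close>. It is meaningful on the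
  labels in \<open>\<nu> ` M\<close>, provided that \<open>\<nu>\<close> is injective on \<open>M\<close>.
\<close>

definition beta_inv ::
  "('a \<Rightarrow> int^'d \<Rightarrow> 'a) \<Rightarrow> ('a \<Rightarrow> nat) \<Rightarrow> 'a set \<Rightarrow> int^'d \<Rightarrow> nat \<Rightarrow> nat" where
  "beta_inv \<theta> \<nu> M j = \<nu> \<circ> subst_column \<theta> j \<circ> inv_into M \<nu>"

text \<open>
  The second encoding is built from the column at \<open>A \<odot> n\<close>, where \<open>n\<close> is the position of the
  column \<open>\<iota>\<close> that defines the first one. This is forced by the convention that
  \<open>shuffling_relation\<close> relates \<open>\<theta>\<^sub>i \<circ> \<tau>\<close> to \<open>\<tau> \<circ> \<theta>\<^sub>m\<close> with \<open>m = A\<^sup>-\<^sup>1 \<odot> i\<close>: putting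
  \<open>i = A \<odot> n\<close> makes it the column \<open>\<tau> \<circ> \<iota> \<circ> \<tau>\<^sup>-\<^sup>1\<close>, whose image is
  \<open>\<tau> ` range \<iota>\<close>. The column at \<open>A\<^sup>-\<^sup>1 \<odot> n\<close> is
  \<open>\<tau>\<^sup>-\<^sup>1 \<circ> \<iota> \<circ> \<tau>\<close> instead. The two positions agree if \<open>A ** A = mat 1\<close>.
\<close>

definition encoding ::
  "('a \<Rightarrow> int^'d \<Rightarrow> 'a) \<Rightarrow> ('a \<Rightarrow> nat) \<Rightarrow> int^'d \<Rightarrow> 'a \<Rightarrow> nat" where
  "encoding \<theta> \<nu>\<^sub>0 n = \<nu>\<^sub>0 \<circ> subst_column \<theta> n"

definition encoding_bar ::
  "int^'d \<Rightarrow> ('a \<Rightarrow> int^'d \<Rightarrow> 'a) \<Rightarrow> int^'d^'d \<Rightarrow> ('a \<Rightarrow> nat) \<Rightarrow> int^'d \<Rightarrow> 'a \<Rightarrow> nat" where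
  "encoding_bar l \<theta> A \<nu>\<^sub>0 n = encoding \<theta> \<nu>\<^sub>0 n \<circ> subst_column \<theta> (odot A (supp l 1) n)"

end

theory Submission
  imports Defs
begin

text \<open>
  For one substitution step, the shuffling relation says
  \<open>\<theta>\<^bsub>A \<odot> j\<^esub> (\<tau> a) = \<tau> (\<theta>\<^bsub>j\<^esub> a)\<close> for all positions \<open>j\<close> and letters \<open>a\<close>
  (\<open>shuffling_relation_1_iff\<close>). The convention on powers makes it a consequence of the relations for
  all large powers of \<open>\<theta>\<close>. What remains is that it implies the relations for all powers, and that
  it is equivalent to the three conditions.

  \<^bold>\<open>From one step to all powers.\<close> A column of \<open>\<theta>\<^sup>m\<close> is a composition of columns of \<open>\<theta>\<close>, one for
  each digit of its position. The relation can be applied factor by factor provided that \<open>\<odot>\<close>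
  permutes the digits at every level separately and in the same way. In coordinates relative to the
  centre of the box, \<open>\<odot>\<close> is multiplication by the matrix, so what is needed is that the matrix
  commutes with \<open>Q\<close>. This follows from the invariance of the boxes alone: comparing the widths of the
  box and of its image, for the first three powers, shows that the \<open>(i, j)\<close> entry of the matrix
  vanishes unless \<open>\<ell>\<^sub>i = \<ell>\<^sub>j\<close> (\<open>preserves_boxes_entry_zero\<close>, \<open>odot_prepend_digit\<close>,
  \<open>shuffling_relation_power\<close>).

  \<^bold>\<open>One step and the three conditions.\<close> The encoding \<open>\<nu>\<close> labels every minimal set bijectively, since
  columns are injective on minimal sets. If \<open>\<tau>'\<close> satisfies condition (2), then \<open>\<nu>bar\<close> labels \<open>\<tau> ` M\<close>
  bijectively for every minimal set \<open>M\<close>, and condition (3) says precisely that the letters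
  \<open>\<theta>\<^bsub>A \<odot> j\<^esub> (\<tau> a)\<close> and \<open>\<tau> (\<theta>\<^bsub>j\<^esub> a)\<close> have the same \<open>\<nu>bar\<close>-label for all \<open>a \<in> M\<close>
  (\<open>conjugate_beta_inv_iff\<close>). By condition (1) both letters lie in \<open>\<tau> ` \<theta>\<^bsub>j\<^esub> (M)\<close>, where the label
  determines the letter, so they are equal. By primitivity the minimal sets cover the alphabet
  (\<open>minimal_sets_cover\<close>), which gives the relation for every letter. Conversely, the relation yields
  (1) and (3) directly, and the label permutation of (2) is constructed in
  \<open>label_permutation_exists\<close>.
\<close>

section \<open>The centred action on boxes\<close>

text \<open>
  Twice the position of \<open>j\<close> relative to the centre of \<open>supp l m\<close>. The doubling keeps the
  coordinates integral, and \<open>\<odot>\<close> becomes linear in them.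
\<close>

definition centred :: "int^'d \<Rightarrow> nat \<Rightarrow> int^'d \<Rightarrow> int^'d" where
  "centred l m j = (\<chi> i. 2 * j $ i - ((l $ i) ^ m - 1))"

lemma supp_less: "x \<in> supp l m \<Longrightarrow> x $ i < (l $ i) ^ m"
  by (simp add: supp_def)

lemma coordinate_image_supp:
  assumes "\<forall>k. l $ k \<ge> 2"
  shows "(\<lambda>x. x $ i) ` supp l m = {0..(l $ i) ^ m - 1}"
proof
  show "(\<lambda>x. x $ i) ` supp l m \<subseteq> {0..(l $ i) ^ m - 1}"
    by (auto simp: supp_def)
  show "{0..(l $ i) ^ m - 1} \<subseteq> (\<lambda>x. x $ i) ` supp l m"
  proof
    fix a assume a: "a \<in> {0..(l $ i) ^ m - 1}"
    have "0 < (l $ k) ^ m" for k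
      using assms[rule_format, of k] by simp
    with a have "(\<chi> k. if k = i then a else 0) \<in> supp l m"
      by (auto simp: supp_def)
    then show "a \<in> (\<lambda>x. x $ i) ` supp l m"
      by (rule rev_image_eqI) simp
  qed
qed

lemma odot_real_centred:
  assumes "\<forall>k. l $ k \<ge> 2"
  shows "2 * odot_real B (supp l m) x $ i
    = real_of_int ((B *v centred l m x) $ i + ((l $ i) ^ m - 1))"
proof -
  have c: "centre_shift (supp l m) $ k = - (real_of_int ((l $ k) ^ m - 1) / 2)" for k
  proof -
    have "1 \<le> (l $ k) ^ m"
      using assms[rule_format, of k] by (simp add: one_le_power)
    then have "Min {0..(l $ k) ^ m - 1} = 0" "Max {0..(l $ k) ^ m - 1} = (l $ k) ^ m - 1"
      by (auto intro!: Min_eqI Max_eqI)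
    then show ?thesis
      by (simp add: centre_shift_def coordinate_image_supp[OF assms])
  qed
  have "2 * odot_real B (supp l m) x $ i
      = (\<Sum>j\<in>UNIV. 2 * (real_of_int (B $ i $ j) * (real_of_int (x $ j) + centre_shift (supp l m) $ j)))
        - 2 * centre_shift (supp l m) $ i"
    unfolding odot_real_def
    by (simp add: matrix_vector_mult_def map_matrix_def real_vec_def sum_distrib_left
        sum.distrib distrib_left)
  also have "\<dots> = real_of_int ((B *v centred l m x) $ i + ((l $ i) ^ m - 1))"
  proof -
    have "2 * (real_of_int (B $ i $ j) * (real_of_int (x $ j) + centre_shift (supp l m) $ j))
        = real_of_int (B $ i $ j * centred l m x $ j)" for j
      by (simp add: c centred_def field_simps)
    then show ?thesis
      unfolding of_int_add matrix_vector_mult_def vec_lambda_beta of_int_sum c[of i]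
      by (simp only:) simp
  qed
  finally show ?thesis .
qed

lemma odot_real_eq_real_vec_iff:
  assumes "\<forall>k. l $ k \<ge> 2"
  shows "odot_real B (supp l m) x = real_vec y \<longleftrightarrow> centred l m y = B *v centred l m x"
proof -
  have "odot_real B (supp l m) x $ i = real_vec y $ i
      \<longleftrightarrow> centred l m y $ i = (B *v centred l m x) $ i" for i
  proof -
    have "odot_real B (supp l m) x $ i = real_vec y $ i
        \<longleftrightarrow> 2 * odot_real B (supp l m) x $ i = real_of_int (2 * y $ i)"
      by (simp add: real_vec_def)
    also have "\<dots> \<longleftrightarrow> (B *v centred l m x) $ i + ((l $ i) ^ m - 1) = 2 * y $ i"
      unfolding odot_real_centred[OF assms] by (rule of_int_eq_iff)
    finally show ?thesis
      by (auto simp: centred_def)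
  qed
  then show ?thesis
    by (simp add: vec_eq_iff)
qed

lemma odot_eqI:
  assumes "\<forall>k. l $ k \<ge> 2" and "centred l m y = B *v centred l m x"
  shows "odot B (supp l m) x = y"
  using odot_real_eq_real_vec_iff[OF assms(1), THEN iffD2, OF assms(2)]
  by (simp add: odot_def real_vec_def)

lemma
  assumes l: "\<forall>k. l $ k \<ge> 2" and B: "preserves_box B (supp l m)" and x: "x \<in> supp l m"
  shows odot_in_supp: "odot B (supp l m) x \<in> supp l m"
    and centred_odot: "centred l m (odot B (supp l m) x) = B *v centred l m x"
proof -
  obtain y where "y \<in> supp l m" "odot_real B (supp l m) x = real_vec y"
    using B x unfolding preserves_box_def by blast
  then have y: "y \<in> supp l m" "centred l m y = B *v centred l m x"
    by (simp_all add: odot_real_eq_real_vec_iff[OF l])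
  moreover from y(2) have "odot B (supp l m) x = y"
    by (rule odot_eqI[OF l])
  ultimately show "odot B (supp l m) x \<in> supp l m"
    and "centred l m (odot B (supp l m) x) = B *v centred l m x"
    by simp_all
qed

lemma odot_surj_on_supp:
  assumes l: "\<forall>k. l $ k \<ge> 2" and B: "preserves_box B (supp l m)" and y: "y \<in> supp l m"
  obtains x where "x \<in> supp l m" and "centred l m y = B *v centred l m x"
proof -
  have "real_vec y \<in> odot_real B (supp l m) ` supp l m"
    using B y unfolding preserves_box_def by blast
  then obtain x where "x \<in> supp l m" "odot_real B (supp l m) x = real_vec y"
    by force
  then show thesis
    by (intro that) (simp_all add: odot_real_eq_real_vec_iff[OF l])
qed

lemma odot_matrix_inv:
  assumes l: "\<forall>k. l $ k \<ge> 2" and A: "invertible A"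
    and B: "preserves_box (matrix_inv A) (supp l m)" and y: "y \<in> supp l m"
  shows "odot A (supp l m) y \<in> supp l m"
    and "odot (matrix_inv A) (supp l m) (odot A (supp l m) y) = y"
    and "odot A (supp l m) (odot (matrix_inv A) (supp l m) y) = y"
proof -
  have inv: "A ** matrix_inv A = mat 1"
    using A unfolding invertible_def matrix_inv_def
    by (metis (mono_tags, lifting) someI_ex)
  obtain x where x: "x \<in> supp l m" "centred l m y = matrix_inv A *v centred l m x"
    using odot_surj_on_supp[OF l B y] .
  have "centred l m x = A *v centred l m y"
    by (simp add: x(2) matrix_vector_mul_assoc inv)
  then have x': "odot A (supp l m) y = x"
    by (rule odot_eqI[OF l])
  show "odot A (supp l m) y \<in> supp l m"
    using x(1) x' by simp
  show "odot (matrix_inv A) (supp l m) (odot A (supp l m) y) = y"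
    unfolding x' by (rule odot_eqI[OF l x(2)])
  show "odot A (supp l m) (odot (matrix_inv A) (supp l m) y) = y"
    by (rule odot_eqI[OF l]) (simp add: centred_odot[OF l B y] matrix_vector_mul_assoc inv)
qed

lemma ball_odot_reindex:
  assumes l: "\<forall>k. l $ k \<ge> 2" and A: "invertible A"
    and B: "preserves_box (matrix_inv A) (supp l m)"
  shows "(\<forall>i\<in>supp l m. P i (odot (matrix_inv A) (supp l m) i))
    \<longleftrightarrow> (\<forall>j\<in>supp l m. P (odot A (supp l m) j) j)"
proof (intro iffI ballI)
  fix j assume "\<forall>i\<in>supp l m. P i (odot (matrix_inv A) (supp l m) i)" and j: "j \<in> supp l m"
  then have "P (odot A (supp l m) j) (odot (matrix_inv A) (supp l m) (odot A (supp l m) j))"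
    using odot_matrix_inv(1)[OF l A B j] by blast
  then show "P (odot A (supp l m) j) j"
    by (simp only: odot_matrix_inv(2)[OF l A B j])
next
  fix i assume "\<forall>j\<in>supp l m. P (odot A (supp l m) j) j" and i: "i \<in> supp l m"
  then have "P (odot A (supp l m) (odot (matrix_inv A) (supp l m) i)) (odot (matrix_inv A) (supp l m) i)"
    using odot_in_supp[OF l B i] by blast
  then show "P i (odot (matrix_inv A) (supp l m) i)"
    by (simp only: odot_matrix_inv(3)[OF l A B i])
qed

section \<open>Compatibility with the digit expansion\<close>

text \<open>
  Both sides are the width of the box in direction \<open>i\<close>. On the left it is computed as the width of
  the image of the box: the maximum of the \<open>i\<close>-th coordinate of a linear image of a centred box is
  attained at the vertex whose signs are those of row \<open>i\<close>.
\<close>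

lemma preserves_box_row_sum:
  fixes l :: "int^'d"
  assumes l: "\<forall>k. l $ k \<ge> 2" and B: "preserves_box B (supp l m)"
  shows "(\<Sum>j\<in>UNIV. \<bar>B $ i $ j\<bar> * ((l $ j) ^ m - 1)) = (l $ i) ^ m - 1"
proof (rule antisym)
  have pos: "0 < (l $ k) ^ m" for k
    using l[rule_format, of k] by simp
  define x :: "int^'d" where "x = (\<chi> j. if B $ i $ j \<ge> 0 then (l $ j) ^ m - 1 else 0)"
  have x: "x \<in> supp l m"
    using pos by (simp add: x_def supp_def int_one_le_iff_zero_less)
  have "(\<Sum>j\<in>UNIV. \<bar>B $ i $ j\<bar> * ((l $ j) ^ m - 1)) = (B *v centred l m x) $ i"
    by (auto simp: matrix_vector_mult_def centred_def x_def algebra_simps intro!: sum.cong)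
  also have "\<dots> = centred l m (odot B (supp l m) x) $ i"
    by (simp add: centred_odot[OF l B x])
  also have "\<dots> \<le> (l $ i) ^ m - 1"
  proof -
    have "odot B (supp l m) x $ i < (l $ i) ^ m"
      by (rule supp_less[OF odot_in_supp[OF l B x]])
    then show ?thesis
      by (simp add: centred_def)
  qed
  finally show "(\<Sum>j\<in>UNIV. \<bar>B $ i $ j\<bar> * ((l $ j) ^ m - 1)) \<le> (l $ i) ^ m - 1" .
  have "(\<chi> k. (l $ k) ^ m - 1) \<in> supp l m"
    using pos by (simp add: supp_def int_one_le_iff_zero_less)
  from odot_surj_on_supp[OF l B this] obtain z where z: "z \<in> supp l m"
    and top: "centred l m (\<chi> k. (l $ k) ^ m - 1) = B *v centred l m z" .
  have "(l $ i) ^ m - 1 = (B *v centred l m z) $ i"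
    unfolding top[symmetric] by (simp add: centred_def)
  also have "\<dots> = (\<Sum>j\<in>UNIV. B $ i $ j * centred l m z $ j)"
    by (simp add: matrix_vector_mult_def)
  also have "\<dots> \<le> (\<Sum>j\<in>UNIV. \<bar>B $ i $ j\<bar> * ((l $ j) ^ m - 1))"
  proof (rule sum_mono)
    fix j
    have "0 \<le> z $ j" "z $ j < (l $ j) ^ m"
      using z by (auto simp: supp_def)
    then have "\<bar>centred l m z $ j\<bar> \<le> (l $ j) ^ m - 1"
      by (simp add: centred_def abs_le_iff)
    then have "\<bar>B $ i $ j * centred l m z $ j\<bar> \<le> \<bar>B $ i $ j\<bar> * ((l $ j) ^ m - 1)"
      unfolding abs_mult by (rule mult_left_mono) simp
    then show "B $ i $ j * centred l m z $ j \<le> \<bar>B $ i $ j\<bar> * ((l $ j) ^ m - 1)"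
      by (rule order_trans[OF abs_ge_self])
  qed
  finally show "(l $ i) ^ m - 1 \<le> (\<Sum>j\<in>UNIV. \<bar>B $ i $ j\<bar> * ((l $ j) ^ m - 1))" .
qed

text \<open>
  With the weights \<open>w j = \<bar>B $ i $ j\<bar> * (l $ j - 1)\<close>, the row sums at levels \<open>1\<close>, \<open>2\<close> and \<open>3\<close>
  fix the moments \<open>\<Sum>j. w j * (l $ j) ^ p\<close> for \<open>p = 0, 1, 2\<close> to be \<open>(l $ i - 1) * (l $ i) ^ p\<close>.
  So the \<open>l $ j\<close> have mean \<open>l $ i\<close> and variance \<open>0\<close> under these weights.
\<close>

lemma preserves_boxes_entry_zero:
  assumes l: "\<forall>k. l $ k \<ge> 2" and B: "\<forall>m. preserves_box B (supp l m)"
    and "B $ i $ j \<noteq> 0"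
  shows "l $ j = l $ i"
proof -
  define b where "b k = \<bar>B $ i $ k\<bar>" for k
  define L where "L = l $ i"
  have row: "(\<Sum>k\<in>UNIV. b k * ((l $ k) ^ m - 1)) = L ^ m - 1" for m
    unfolding b_def L_def by (rule preserves_box_row_sum[OF l B[rule_format]])
  have "(\<Sum>k\<in>UNIV. b k * (l $ k - 1) * (l $ k - L)\<^sup>2)
      = (\<Sum>k\<in>UNIV. b k * ((l $ k) ^ 3 - 1) - (2 * L + 1) * (b k * ((l $ k) ^ 2 - 1))
          + (L\<^sup>2 + 2 * L) * (b k * ((l $ k) ^ 1 - 1)))"
    \<comment> \<open>\<open>(x - 1) (x - L)\<^sup>2\<close> is a combination of \<open>x\<^sup>3 - 1\<close>, \<open>x\<^sup>2 - 1\<close> and \<open>x - 1\<close>.\<close>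
    by (rule sum.cong) (simp_all add: algebra_simps power2_eq_square power3_eq_cube)
  also have "\<dots> = (L ^ 3 - 1) - (2 * L + 1) * (L ^ 2 - 1) + (L\<^sup>2 + 2 * L) * (L ^ 1 - 1)"
    by (simp only: sum.distrib sum_subtractf sum_distrib_left[symmetric] row)
  also have "\<dots> = 0"
    by (simp add: algebra_simps power2_eq_square power3_eq_cube)
  finally have "(\<Sum>k\<in>UNIV. b k * (l $ k - 1) * (l $ k - L)\<^sup>2) = 0" .
  moreover have "0 \<le> b k * (l $ k - 1) * (l $ k - L)\<^sup>2" for k
    using l[rule_format, of k] by (simp add: b_def)
  ultimately have "b j * (l $ j - 1) * (l $ j - L)\<^sup>2 = 0"
    by (simp add: sum_nonneg_eq_0_iff)
  then show ?thesis
    using l[rule_format, of j] \<open>B $ i $ j \<noteq> 0\<close> by (simp add: b_def L_def)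
qed

lemma preserves_boxes_commute_diagonal:
  assumes "\<forall>k. l $ k \<ge> 2" and "\<forall>m. preserves_box B (supp l m)"
  shows "B *v (\<chi> k. l $ k * x $ k) = (\<chi> k. l $ k * (B *v x) $ k)"
proof -
  have "B $ i $ j * (l $ j * x $ j) = l $ i * (B $ i $ j * x $ j)" for i j
    using preserves_boxes_entry_zero[OF assms, of i j] by (cases "B $ i $ j = 0") auto
  then show ?thesis
    unfolding matrix_vector_mult_def vec_eq_iff vec_lambda_beta sum_distrib_left
    by (intro allI sum.cong refl)
qed

definition prepend_digit :: "int^'d \<Rightarrow> int^'d \<Rightarrow> int^'d \<Rightarrow> int^'d" where
  "prepend_digit l r q = (\<chi> k. r $ k + l $ k * q $ k)"

lemma prepend_digit_mod_div: "prepend_digit l (\<chi> k. i $ k mod l $ k) (\<chi> k. i $ k div l $ k) = i"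
  by (simp add: prepend_digit_def vec_eq_iff)

lemma prepend_digit_in_supp:
  assumes r: "r \<in> supp l 1" and q: "q \<in> supp l m"
  shows "prepend_digit l r q \<in> supp l (Suc m)"
proof -
  have "0 \<le> r $ k + l $ k * q $ k \<and> r $ k + l $ k * q $ k < (l $ k) ^ Suc m" for k
  proof -
    have r': "0 \<le> r $ k" "r $ k < l $ k" and q': "0 \<le> q $ k" "q $ k + 1 \<le> (l $ k) ^ m"
      using r q by (auto simp: supp_def add1_zle_eq)
    from r' q'(2) have "l $ k * (q $ k + 1) \<le> l $ k * (l $ k) ^ m"
      by (intro mult_left_mono) auto
    with r' q' show ?thesis
      by (auto simp: algebra_simps)
  qed
  then show ?thesis
    by (simp add: supp_def prepend_digit_def)
qed

lemma
  assumes l: "\<forall>k. l $ k \<ge> 2"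
  shows last_digit_in_supp: "(\<chi> k. i $ k mod l $ k) \<in> supp l 1"
    and quotient_in_supp: "i \<in> supp l (Suc m) \<Longrightarrow> (\<chi> k. i $ k div l $ k) \<in> supp l m"
proof -
  have pos: "0 < l $ k" for k
    using l[rule_format, of k] by simp
  then show "(\<chi> k. i $ k mod l $ k) \<in> supp l 1"
    by (simp add: supp_def)
  show "(\<chi> k. i $ k div l $ k) \<in> supp l m" if "i \<in> supp l (Suc m)"
  proof -
    have "0 \<le> i $ k div l $ k \<and> i $ k div l $ k < (l $ k) ^ m" for k
    proof -
      have "0 \<le> i $ k" "i $ k < (l $ k) ^ m * l $ k"
        using that by (auto simp: supp_def mult.commute)
      moreover have "i $ k div l $ k * l $ k \<le> i $ k"
        using pos[of k] by (simp add: minus_mod_eq_div_mult[symmetric])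
      ultimately have "i $ k div l $ k * l $ k < (l $ k) ^ m * l $ k"
        by linarith
      then have "i $ k div l $ k < (l $ k) ^ m"
        by (rule mult_right_less_imp_less) (use pos[of k] in simp)
      then show ?thesis
        using pos[of k] \<open>0 \<le> i $ k\<close> by (simp add: pos_imp_zdiv_nonneg_iff)
    qed
    then show ?thesis
      by (simp add: supp_def)
  qed
qed

lemma
  assumes "r \<in> supp l 1"
  shows prepend_digit_mod: "(\<chi> k. prepend_digit l r q $ k mod l $ k) = r"
    and prepend_digit_div: "(\<chi> k. prepend_digit l r q $ k div l $ k) = q"
proof -
  have "(r $ k + l $ k * q $ k) mod l $ k = r $ k \<and> (r $ k + l $ k * q $ k) div l $ k = q $ k" for k
  proof -
    have "0 \<le> r $ k" "r $ k < l $ k"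
      using assms by (simp_all add: supp_def)
    then show ?thesis
      by simp
  qed
  then show "(\<chi> k. prepend_digit l r q $ k mod l $ k) = r"
    and "(\<chi> k. prepend_digit l r q $ k div l $ k) = q"
    by (simp_all add: prepend_digit_def vec_eq_iff)
qed

lemma power_column_prepend_digit:
  assumes "r \<in> supp l 1"
  shows "power_column l \<theta> (Suc m) (prepend_digit l r q) = subst_column \<theta> r \<circ> power_column l \<theta> m q"
  using prepend_digit_mod[OF assms, of q] prepend_digit_div[OF assms, of q] by simp

lemma power_column_1:
  assumes "j \<in> supp l 1"
  shows "power_column l \<theta> 1 j = subst_column \<theta> j"
proof -
  have "(\<chi> k. j $ k mod l $ k) = j"
    using assms by (simp add: supp_def vec_eq_iff)
  then show ?thesis
    by simp
qed

text \<open>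
  The centre of \<open>supp l (Suc m)\<close> is obtained from those of \<open>supp l 1\<close> and \<open>supp l m\<close> by the same
  digit rule, and \<open>B\<close> commutes with \<open>Q\<close>; hence \<open>\<odot>\<close> acts on each digit separately.
\<close>

lemma odot_prepend_digit:
  assumes l: "\<forall>k. l $ k \<ge> 2" and B: "\<forall>m. preserves_box B (supp l m)"
    and r: "r \<in> supp l 1" and q: "q \<in> supp l m"
  shows "odot B (supp l (Suc m)) (prepend_digit l r q)
    = prepend_digit l (odot B (supp l 1) r) (odot B (supp l m) q)"
proof (rule odot_eqI[OF l])
  have split: "centred l (Suc m) (prepend_digit l r' q')
      = centred l 1 r' + (\<chi> k. l $ k * centred l m q' $ k)" for r' q'
    by (simp add: centred_def prepend_digit_def vec_eq_iff algebra_simps)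
  show "centred l (Suc m) (prepend_digit l (odot B (supp l 1) r) (odot B (supp l m) q))
      = B *v centred l (Suc m) (prepend_digit l r q)"
    unfolding split centred_odot[OF l B[rule_format] r] centred_odot[OF l B[rule_format] q]
    by (simp add: matrix_vector_right_distrib preserves_boxes_commute_diagonal[OF l B])
qed

section \<open>Columns and minimal sets\<close>

lemma power_column_comp:
  assumes l: "\<forall>k. l $ k \<ge> 2" and "i \<in> supp l p" and j: "j \<in> supp l q"
  shows "\<exists>h\<in>supp l (p + q). power_column l \<theta> p i \<circ> power_column l \<theta> q j = power_column l \<theta> (p + q) h"
  using assms(2)
proof (induction p arbitrary: i)
  case 0
  then show ?case
    by (intro bexI[of _ j]) (simp_all add: j)
next
  case (Suc p)
  let ?r = "\<chi> k. i $ k mod l $ k" and ?q = "\<chi> k. i $ k div l $ k"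
  have r: "?r \<in> supp l 1"
    by (rule last_digit_in_supp[OF l])
  obtain h where h: "h \<in> supp l (p + q)"
    "power_column l \<theta> p ?q \<circ> power_column l \<theta> q j = power_column l \<theta> (p + q) h"
    using Suc.IH[OF quotient_in_supp[OF l Suc.prems]] by (rule bexE)
  have "power_column l \<theta> (Suc p) i \<circ> power_column l \<theta> q j
      = subst_column \<theta> ?r \<circ> (power_column l \<theta> p ?q \<circ> power_column l \<theta> q j)"
    by (simp only: power_column.simps comp_assoc)
  also have "\<dots> = power_column l \<theta> (Suc (p + q)) (prepend_digit l ?r h)"
    by (simp only: h(2) power_column_prepend_digit[OF r])
  finally have "power_column l \<theta> (Suc p) i \<circ> power_column l \<theta> q j
      = power_column l \<theta> (Suc p + q) (prepend_digit l ?r h)"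
    by (simp only: add_Suc)
  moreover have "prepend_digit l ?r h \<in> supp l (Suc p + q)"
    unfolding add_Suc by (rule prepend_digit_in_supp[OF r h(1)])
  ultimately show ?case
    by (rule bexI)
qed

lemma column_number_le:
  fixes \<theta> :: "'a::finite \<Rightarrow> int^'d \<Rightarrow> 'a"
  assumes "1 \<le> k" and "j \<in> supp l k"
  shows "column_number l \<theta> \<le> card (range (power_column l \<theta> k j))"
proof -
  have "{card (range (power_column l \<theta> k j)) | k j. 1 \<le> k \<and> j \<in> supp l k} \<subseteq> {..card (UNIV :: 'a set)}"
    by (auto intro: card_mono[OF finite subset_UNIV])
  then have "finite {card (range (power_column l \<theta> k j)) | k j. 1 \<le> k \<and> j \<in> supp l k}"
    by (rule finite_subset) simp
  then show ?thesis
    unfolding column_number_def by (rule Min_le) (use assms in blast)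
qed

text \<open>
  A column cannot shrink a minimal set, because its image is again the image of a column of a power.
\<close>

lemma
  assumes l: "\<forall>k. l $ k \<ge> 2" and M: "minimal_set l \<theta> M" and i: "i \<in> supp l p"
  shows minimal_set_image: "minimal_set l \<theta> (power_column l \<theta> p i ` M)"
    and power_column_inj_on_minimal_set: "inj_on (power_column l \<theta> p i) M"
proof -
  obtain k j where k: "1 \<le> k" "j \<in> supp l k" "M = range (power_column l \<theta> k j)"
    and card: "card M = column_number l \<theta>"
    using M by (auto simp: minimal_set_def)
  obtain h where h: "h \<in> supp l (p + k)"
    "power_column l \<theta> p i \<circ> power_column l \<theta> k j = power_column l \<theta> (p + k) h"
    using power_column_comp[OF l i k(2)] by blast
  have img: "power_column l \<theta> p i ` M = range (power_column l \<theta> (p + k) h)"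
    by (simp add: k(3) h(2)[symmetric] image_comp)
  have "column_number l \<theta> \<le> card (power_column l \<theta> p i ` M)"
    unfolding img by (rule column_number_le) (use k h in auto)
  moreover have "card (power_column l \<theta> p i ` M) \<le> card M"
    by (rule card_image_le) simp
  ultimately have eq: "card (power_column l \<theta> p i ` M) = card M"
    using card by simp
  then show "inj_on (power_column l \<theta> p i) M"
    by (intro eq_card_imp_inj_on) simp_all
  show "minimal_set l \<theta> (power_column l \<theta> p i ` M)"
    unfolding minimal_set_def using eq card img h(1) k(1)
    by (intro conjI exI[of _ "p + k"] bexI[of _ h]) auto
qed

lemma
  assumes l: "\<forall>k. l $ k \<ge> 2" and M: "minimal_set l \<theta> M" and j: "j \<in> supp l 1"
  shows minimal_set_column_image: "minimal_set l \<theta> (subst_column \<theta> j ` M)"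
    and column_inj_on_minimal_set: "inj_on (subst_column \<theta> j) M"
  using minimal_set_image[OF assms] power_column_inj_on_minimal_set[OF assms]
  unfolding power_column_1[OF j] by simp_all

text \<open>
  By primitivity every letter is the image, under a column of a power, of a letter of a given
  minimal set.
\<close>

lemma minimal_sets_cover:
  assumes l: "\<forall>k. l $ k \<ge> 2" and prim: "primitive_subst l \<theta>"
    and M: "minimal_set l \<theta> M"
  obtains M' where "minimal_set l \<theta> M'" and "b \<in> M'"
proof -
  obtain a where a: "a \<in> M"
    using M by (auto simp: minimal_set_def)
  obtain k j where "j \<in> supp l k" "power_column l \<theta> k j a = b"
    using prim unfolding primitive_subst_def by blast
  then show thesis
    using that[of "power_column l \<theta> k j ` M"] minimal_set_image[OF l M] a by blast
qed

section \<open>The shuffling relation\<close>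

text \<open>
  Since \<open>\<odot>\<close> acts on each digit separately, the relation for \<open>\<theta>\<close> can be applied to one column
  after the other in the composition that defines a column of \<open>\<theta>\<^sup>m\<close>.
\<close>

lemma shuffling_relation_power:
  assumes l: "\<forall>k. l $ k \<ge> 2" and B: "\<forall>m. preserves_box (matrix_inv A) (supp l m)"
    and one: "shuffling_relation l \<theta> \<tau> A 1"
  shows "shuffling_relation l \<theta> \<tau> A m"
proof (induction m)
  case 0
  then show ?case
    by (simp add: shuffling_relation_def)
next
  case (Suc m)
  show ?case
    unfolding shuffling_relation_def
  proof (intro allI ballI)
    fix a i assume i: "i \<in> supp l (Suc m)"
    define r where "r = (\<chi> k. i $ k mod l $ k)"
    define q where "q = (\<chi> k. i $ k div l $ k)"
    have r: "r \<in> supp l 1" and q: "q \<in> supp l m" and i_eq: "i = prepend_digit l r q"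
      unfolding r_def q_def
      by (simp_all only: last_digit_in_supp[OF l] quotient_in_supp[OF l i] prepend_digit_mod_div)
    let ?o = "\<lambda>m. odot (matrix_inv A) (supp l m)"
    have r': "?o 1 r \<in> supp l 1"
      by (rule odot_in_supp[OF l B[rule_format] r])
    have "power_column l \<theta> (Suc m) i (\<tau> a) = subst_column \<theta> r (power_column l \<theta> m q (\<tau> a))"
      unfolding i_eq power_column_prepend_digit[OF r] by simp
    also have "\<dots> = subst_column \<theta> r (\<tau> (power_column l \<theta> m (?o m q) a))"
      using Suc.IH q by (simp add: shuffling_relation_def)
    also have "\<dots> = \<tau> (subst_column \<theta> (?o 1 r) (power_column l \<theta> m (?o m q) a))"
      using one[unfolded shuffling_relation_def, rule_format, OF r]
      unfolding power_column_1[OF r] power_column_1[OF r'] by blast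
    also have "\<dots> = \<tau> (power_column l \<theta> (Suc m) (?o (Suc m) i) a)"
      unfolding i_eq odot_prepend_digit[OF l B r q] power_column_prepend_digit[OF r'] by simp
    finally show "power_column l \<theta> (Suc m) i (\<tau> a) = \<tau> (power_column l \<theta> (Suc m) (?o (Suc m) i) a)" .
  qed
qed

text \<open>
  Indexing by \<open>j = A\<^sup>-\<^sup>1 \<odot> i\<close> matches the positions in the second encoding and in condition (3).
\<close>

lemma shuffling_relation_1_iff:
  assumes l: "\<forall>k. l $ k \<ge> 2" and A: "invertible A"
    and B: "preserves_box (matrix_inv A) (supp l 1)"
  shows "shuffling_relation l \<theta> \<tau> A 1 \<longleftrightarrow>
    (\<forall>j\<in>supp l 1. \<forall>a. subst_column \<theta> (odot A (supp l 1) j) (\<tau> a) = \<tau> (subst_column \<theta> j a))"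
    (is "_ \<longleftrightarrow> ?R")
proof -
  let ?o = "odot (matrix_inv A) (supp l 1)"
  have "shuffling_relation l \<theta> \<tau> A 1 \<longleftrightarrow>
      (\<forall>i\<in>supp l 1. \<forall>a. subst_column \<theta> i (\<tau> a) = \<tau> (subst_column \<theta> (?o i) a))"
    unfolding shuffling_relation_def
    using power_column_1[of _ l \<theta>] odot_in_supp[OF l B] by (metis (no_types, lifting))
  also have "\<dots> \<longleftrightarrow> ?R"
    by (rule ball_odot_reindex[OF l A B])
  finally show ?thesis .
qed

text \<open>
  If \<open>\<tau>'\<close> intertwines the encodings and the labels of a minimal set \<open>M\<close> exhaust \<open>{1..c}\<close>, every
  label is \<open>\<tau>' (\<nu> a)\<close> for a letter \<open>a \<in> M\<close>, and conjugation by \<open>\<tau>'\<close> turns the equation between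
  label maps into one between letters.
\<close>

lemma conjugate_beta_inv_iff:
  assumes \<nu>: "bij_betw \<nu> M {1..c}" and \<tau>': "\<tau>' permutes {1..c}"
    and intertwine: "\<tau>' \<circ> \<nu> = \<nu>bar \<circ> \<tau>"
  shows "(\<forall>s\<in>{1..c}. (\<tau>' \<circ> beta_inv \<theta> \<nu> M j \<circ> inv \<tau>') s = beta_inv \<theta> \<nu>bar (\<tau> ` M) i s)
    \<longleftrightarrow> (\<forall>a\<in>M. \<nu>bar (\<tau> (subst_column \<theta> j a)) = \<nu>bar (subst_column \<theta> i (\<tau> a)))"
proof -
  have comm: "\<tau>' (\<nu> x) = \<nu>bar (\<tau> x)" for x
    using intertwine by (metis comp_apply)
  have "bij_betw (\<tau>' \<circ> \<nu>) M {1..c}"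
    using \<nu> permutes_imp_bij[OF \<tau>'] by (rule bij_betw_trans)
  then have bij: "bij_betw (\<nu>bar \<circ> \<tau>) M {1..c}"
    unfolding intertwine .
  then have inj: "inj_on \<nu>bar (\<tau> ` M)"
    by (auto simp: bij_betw_def dest: inj_on_imageI)
  have labels: "{1..c} = (\<lambda>a. \<nu>bar (\<tau> a)) ` M"
    using bij by (auto simp: bij_betw_def)
  have "(\<tau>' \<circ> beta_inv \<theta> \<nu> M j \<circ> inv \<tau>') (\<nu>bar (\<tau> a)) = \<nu>bar (\<tau> (subst_column \<theta> j a))"
    if "a \<in> M" for a
    using that \<nu> comm permutes_inverses(2)[OF \<tau>']
    by (simp add: beta_inv_def bij_betw_def inv_into_f_f flip: comm)
  moreover have "beta_inv \<theta> \<nu>bar (\<tau> ` M) i (\<nu>bar (\<tau> a)) = \<nu>bar (subst_column \<theta> i (\<tau> a))"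
    if "a \<in> M" for a
    using that inj by (simp add: beta_inv_def inv_into_f_f)
  ultimately show ?thesis
    unfolding labels by auto
qed

text \<open>
  The column at \<open>n\<close> is injective on \<open>M\<close>, and \<open>M\<close> has as many elements as its image.
\<close>

lemma encoding_bij_betw_minimal_set:
  assumes l: "\<forall>k. l $ k \<ge> 2" and n: "n \<in> supp l 1"
    and \<nu>\<^sub>0: "bij_betw \<nu>\<^sub>0 (range (subst_column \<theta> n)) {1..column_number l \<theta>}"
    and M: "minimal_set l \<theta> M"
  shows "bij_betw (encoding \<theta> \<nu>\<^sub>0 n) M {1..column_number l \<theta>}"
proof -
  have inj: "inj_on (subst_column \<theta> n) M"
    by (rule column_inj_on_minimal_set[OF l M n])
  have "card (subst_column \<theta> n ` M) = card (range (subst_column \<theta> n))"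
    using card_image[OF inj] M bij_betw_same_card[OF \<nu>\<^sub>0] by (simp add: minimal_set_def)
  then have "subst_column \<theta> n ` M = range (subst_column \<theta> n)"
    by (intro card_subset_eq) auto
  with inj have "bij_betw (subst_column \<theta> n) M (range (subst_column \<theta> n))"
    by (simp add: bij_betw_def)
  then show ?thesis
    unfolding encoding_def using \<nu>\<^sub>0 by (rule bij_betw_trans)
qed

text \<open>
  By the relation, the column at \<open>A \<odot> n\<close> is \<open>\<tau> \<circ> \<iota> \<circ> \<tau>\<^sup>-\<^sup>1\<close>, where \<open>\<iota>\<close> is the column at \<open>n\<close>.
  So the label \<open>\<nu>bar (\<tau> a) = \<nu> (\<tau> (\<iota> a))\<close> depends only on \<open>\<iota> a\<close>, that is, on the label
  \<open>\<nu> a = \<nu>\<^sub>0 (\<iota> a)\<close>. The induced map of labels is bijective because \<open>\<tau>\<close> maps the image of \<open>\<iota>\<close>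
  onto the image of the column at \<open>A \<odot> n\<close>, which is therefore a minimal set, and every minimal
  set meets each label exactly once.
\<close>

lemma label_permutation_exists:
  assumes l: "\<forall>k. l $ k \<ge> 2" and A: "invertible A"
    and B: "preserves_box (matrix_inv A) (supp l 1)"
    and \<tau>: "bij \<tau>" and rel: "shuffling_relation l \<theta> \<tau> A 1"
    and n: "n \<in> supp l 1"
    and \<nu>\<^sub>0: "bij_betw \<nu>\<^sub>0 (range (subst_column \<theta> n)) {1..column_number l \<theta>}"
  shows "\<exists>\<tau>'. \<tau>' permutes {1..column_number l \<theta>} \<and>
    \<tau>' \<circ> encoding \<theta> \<nu>\<^sub>0 n = encoding_bar l \<theta> A \<nu>\<^sub>0 n \<circ> \<tau>"
proof -
  let ?\<iota> = "subst_column \<theta> n" and ?\<nu> = "encoding \<theta> \<nu>\<^sub>0 n" and ?C = "{1..column_number l \<theta>}"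
  let ?M = "range ?\<iota>" and ?An = "odot A (supp l 1) n"
  have An: "?An \<in> supp l 1"
    by (rule odot_matrix_inv(1)[OF l A B n])
  have rel': "subst_column \<theta> ?An (\<tau> a) = \<tau> (?\<iota> a)" for a
    using rel n unfolding shuffling_relation_1_iff[OF l A B] by blast
  have "\<tau> ` ?M = range (subst_column \<theta> ?An \<circ> \<tau>)"
    by (simp only: image_image comp_def rel')
  also have "\<dots> = range (power_column l \<theta> 1 ?An)"
    unfolding power_column_1[OF An] image_comp[symmetric] bij_is_surj[OF \<tau>] ..
  finally have "\<tau> ` ?M = range (power_column l \<theta> 1 ?An)" .
  moreover have "card (\<tau> ` ?M) = column_number l \<theta>"
    using bij_betw_same_card[OF \<nu>\<^sub>0] card_image[OF inj_on_subset[OF bij_is_inj[OF \<tau>] subset_UNIV]]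
    by simp
  ultimately have "minimal_set l \<theta> (\<tau> ` ?M)"
    unfolding minimal_set_def using An by (intro conjI exI[of _ 1]) auto
  then have \<nu>_\<tau>M: "bij_betw ?\<nu> (\<tau> ` ?M) ?C"
    by (rule encoding_bij_betw_minimal_set[OF l n \<nu>\<^sub>0])
  define f where "f = ?\<nu> \<circ> \<tau> \<circ> inv_into ?M \<nu>\<^sub>0"
  have "bij_betw \<tau> ?M (\<tau> ` ?M)"
    using \<tau> by (meson bij_betw_subset subset_UNIV)
  then have f: "bij_betw f ?C ?C"
    unfolding f_def using bij_betw_inv_into[OF \<nu>\<^sub>0] \<nu>_\<tau>M by (intro bij_betw_trans)
  \<comment> \<open>\<open>f\<close> is only meaningful on labels; outside, a permutation of \<open>?C\<close> must be the identity.\<close>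
  define \<tau>' where "\<tau>' s = (if s \<in> ?C then f s else s)" for s
  have "\<tau>' permutes ?C"
  proof (rule bij_imp_permutes)
    show "bij_betw \<tau>' ?C ?C"
      using f by (rule bij_betw_cong[THEN iffD1, rotated]) (simp add: \<tau>'_def)
  qed (auto simp: \<tau>'_def)
  moreover have "\<tau>' (?\<nu> a) = encoding_bar l \<theta> A \<nu>\<^sub>0 n (\<tau> a)" for a
  proof -
    have "?\<nu> a \<in> ?C"
      using \<nu>\<^sub>0 by (auto simp: encoding_def bij_betw_def)
    then have "\<tau>' (?\<nu> a) = ?\<nu> (\<tau> (inv_into ?M \<nu>\<^sub>0 (\<nu>\<^sub>0 (?\<iota> a))))"
      by (simp add: \<tau>'_def f_def encoding_def)
    also have "\<dots> = ?\<nu> (\<tau> (?\<iota> a))"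
      using \<nu>\<^sub>0 by (simp add: bij_betw_def inv_into_f_f)
    finally show ?thesis
      unfolding encoding_bar_def comp_apply rel' .
  qed
  ultimately show ?thesis
    by (intro exI[of _ \<tau>']) auto
qed

theorem theorem16:
  fixes l :: "int^'d" and \<theta> :: "'a::finite \<Rightarrow> int^'d \<Rightarrow> 'a"
    and \<tau> :: "'a \<Rightarrow> 'a" and A :: "int^'d^'d"
    and n :: "int^'d" and M\<^sub>0 :: "'a set" and \<nu>\<^sub>0 \<nu> \<nu>bar :: "'a \<Rightarrow> nat" and c :: nat
  assumes "\<forall>k. l $ k \<ge> 2"
    and "primitive_subst l \<theta>" and "aperiodic_subst l \<theta>"
    and "c = column_number l \<theta>" and "c > 1"
    and "bij \<tau>"
    and "invertible A"
    and "\<forall>m. preserves_box (matrix_inv A) (supp l m)"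
    \<comment> \<open>\<open>\<theta>\<close> has been replaced by a suitable power\<close>
    and "supertile_shuffling l \<theta> \<tau> A \<longrightarrow> shuffling_relation l \<theta> \<tau> A 1"
    and "n \<in> supp l 1" and "subst_column \<theta> n \<circ> subst_column \<theta> n = subst_column \<theta> n"
    and "range (subst_column \<theta> n) = M\<^sub>0" and "minimal_set l \<theta> M\<^sub>0"
    and "bij_betw \<nu>\<^sub>0 M\<^sub>0 {1..c}"
    and "\<nu> = encoding \<theta> \<nu>\<^sub>0 n" and "\<nu>bar = encoding_bar l \<theta> A \<nu>\<^sub>0 n"
  shows "supertile_shuffling l \<theta> \<tau> A \<longleftrightarrow>
    (\<forall>M. minimal_set l \<theta> M \<longrightarrow> (\<forall>j\<in>supp l 1.
        subst_column \<theta> j ` (\<tau> ` M) = \<tau> ` (subst_column \<theta> (odot (matrix_inv A) (supp l 1) j) ` M))) \<and>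
    (\<exists>\<tau>'. \<tau>' permutes {1..c} \<and> \<tau>' \<circ> \<nu> = \<nu>bar \<circ> \<tau> \<and>
      (\<forall>M. minimal_set l \<theta> M \<longrightarrow> (\<forall>j\<in>supp l 1. \<forall>s\<in>{1..c}.
        (\<tau>' \<circ> beta_inv \<theta> \<nu> M j \<circ> inv \<tau>') s =
        beta_inv \<theta> \<nu>bar (\<tau> ` M) (odot A (supp l 1) j) s)))"
proof -
  note l = assms(1) and prim = assms(2) and c = assms(4) and \<tau> = assms(6) and A = assms(7)
    and B = assms(8) and large = assms(9) and n = assms(10)
    and M\<^sub>0 = assms(12) and min = assms(13) and \<nu>\<^sub>0 = assms(14) and \<nu> = assms(15) and \<nu>bar = assms(16)
  let ?A = "odot A (supp l 1)" and ?A' = "odot (matrix_inv A) (supp l 1)"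
  note B1 = B[rule_format, of 1]
  note level_1 = shuffling_relation_1_iff[OF l A B1, of \<theta> \<tau>]
  have "supertile_shuffling l \<theta> \<tau> A \<longleftrightarrow> shuffling_relation l \<theta> \<tau> A 1"
    using large shuffling_relation_power[OF l B] by (auto simp: supertile_shuffling_def)
  also have "\<dots> \<longleftrightarrow> (\<forall>j\<in>supp l 1. \<forall>a. subst_column \<theta> (?A j) (\<tau> a) = \<tau> (subst_column \<theta> j a))"
    (is "_ \<longleftrightarrow> ?shuffle")
    by (rule level_1)
  finally have shuffle: "supertile_shuffling l \<theta> \<tau> A \<longleftrightarrow> ?shuffle" .
  have \<nu>_bij: "bij_betw \<nu> M {1..c}" if "minimal_set l \<theta> M" for M
    unfolding \<nu> c using encoding_bij_betw_minimal_set[OF l n _ that] \<nu>\<^sub>0 M\<^sub>0 c by simp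
  have sets_iff: "(\<forall>M. minimal_set l \<theta> M \<longrightarrow> (\<forall>j\<in>supp l 1.
        subst_column \<theta> j ` (\<tau> ` M) = \<tau> ` (subst_column \<theta> (?A' j) ` M)))
    \<longleftrightarrow> (\<forall>M. minimal_set l \<theta> M \<longrightarrow> (\<forall>j\<in>supp l 1.
        subst_column \<theta> (?A j) ` (\<tau> ` M) = \<tau> ` (subst_column \<theta> j ` M)))"
    (is "?sets' \<longleftrightarrow> ?sets")
    by (intro all_cong1 imp_cong refl ball_odot_reindex[OF l A B1])
  have labels_iff: "(\<forall>M. minimal_set l \<theta> M \<longrightarrow> (\<forall>j\<in>supp l 1. \<forall>s\<in>{1..c}.
        (\<tau>' \<circ> beta_inv \<theta> \<nu> M j \<circ> inv \<tau>') s = beta_inv \<theta> \<nu>bar (\<tau> ` M) (?A j) s))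
    \<longleftrightarrow> (\<forall>M. minimal_set l \<theta> M \<longrightarrow> (\<forall>j\<in>supp l 1. \<forall>a\<in>M.
        \<nu>bar (\<tau> (subst_column \<theta> j a)) = \<nu>bar (subst_column \<theta> (?A j) (\<tau> a))))"
    (is "?labels \<tau>' \<longleftrightarrow> _")
    if "\<tau>' permutes {1..c}" "\<tau>' \<circ> \<nu> = \<nu>bar \<circ> \<tau>" for \<tau>'
    by (intro all_cong1 imp_cong ball_cong refl conjugate_beta_inv_iff[OF \<nu>_bij that])
  show ?thesis
    unfolding shuffle sets_iff
  proof (rule iffI)
    assume rel: ?shuffle
    then have "shuffling_relation l \<theta> \<tau> A 1"
      by (simp only: level_1)
    from label_permutation_exists[OF l A B1 \<tau> this n, of \<nu>\<^sub>0] \<nu>\<^sub>0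
    have "\<exists>\<tau>'. \<tau>' permutes {1..c} \<and> \<tau>' \<circ> \<nu> = \<nu>bar \<circ> \<tau>"
      unfolding M\<^sub>0 \<nu> \<nu>bar c by simp
    then obtain \<tau>' where \<tau>': "\<tau>' permutes {1..c}" "\<tau>' \<circ> \<nu> = \<nu>bar \<circ> \<tau>"
      by (elim exE conjE)
    have sets: ?sets
      using rel by (simp add: image_image del: One_nat_def)
    have labels: "\<forall>M. minimal_set l \<theta> M \<longrightarrow> (\<forall>j\<in>supp l 1. \<forall>a\<in>M.
        \<nu>bar (\<tau> (subst_column \<theta> j a)) = \<nu>bar (subst_column \<theta> (?A j) (\<tau> a)))"
      using rel by (simp del: One_nat_def)
    show "?sets \<and> (\<exists>\<tau>'. \<tau>' permutes {1..c} \<and> \<tau>' \<circ> \<nu> = \<nu>bar \<circ> \<tau> \<and> ?labels \<tau>')"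
      by (intro conjI exI[of _ \<tau>'] sets \<tau>' labels_iff[OF \<tau>', THEN iffD2, OF labels])
  next
    assume "?sets \<and> (\<exists>\<tau>'. \<tau>' permutes {1..c} \<and> \<tau>' \<circ> \<nu> = \<nu>bar \<circ> \<tau> \<and> ?labels \<tau>')"
    then obtain \<tau>' where sets: ?sets and \<tau>': "\<tau>' permutes {1..c}" "\<tau>' \<circ> \<nu> = \<nu>bar \<circ> \<tau>"
      and "?labels \<tau>'"
      by (elim exE conjE)
    note labels = labels_iff[OF \<tau>', THEN iffD1, OF \<open>?labels \<tau>'\<close>]
    show ?shuffle
    proof (intro ballI allI)
      fix j a assume j: "j \<in> supp l 1"
      obtain M where M: "minimal_set l \<theta> M" "a \<in> M"
        using minimal_sets_cover[OF l prim min] .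
      let ?N = "subst_column \<theta> j ` M"
      \<comment> \<open>Both letters lie in \<open>\<tau> ` ?N\<close>, and \<open>\<nu>bar\<close> separates the letters of that set.\<close>
      have "bij_betw (\<tau>' \<circ> \<nu>) ?N {1..c}"
        using \<nu>_bij[OF minimal_set_column_image[OF l M(1) j]] permutes_imp_bij[OF \<tau>'(1)]
        by (rule bij_betw_trans)
      then have "inj_on \<nu>bar (\<tau> ` ?N)"
        unfolding \<tau>'(2) by (auto simp: bij_betw_def dest: inj_on_imageI)
      moreover have "\<nu>bar (subst_column \<theta> (?A j) (\<tau> a)) = \<nu>bar (\<tau> (subst_column \<theta> j a))"
        using labels[rule_format, OF M(1) j M(2)] by (rule sym)
      moreover have "subst_column \<theta> (?A j) (\<tau> a) \<in> \<tau> ` ?N"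
        using sets[rule_format, OF M(1) j] M(2) by blast
      moreover have "\<tau> (subst_column \<theta> j a) \<in> \<tau> ` ?N"
        using M(2) by blast
      ultimately show "subst_column \<theta> (?A j) (\<tau> a) = \<tau> (subst_column \<theta> j a)"
        by (rule inj_onD)
    qed
  qed
qed

end
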